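(* Let $f(\mathbf u)=\sum_{n=1}^N g_n(\mathbf u)$, where each $g_n:\mathbb R_+^D\to\mathbb R_+$, $n=1,\dots,N$, satisfies (F1)–(F4). For $\mathbf a\in\mathbb R^N$ with $\mathbf a\succeq\mathbf 1$ let $f_s(\mathbf u)=\sum_{n=1}^N a_n g_n(\mathbf u)$. Let $\mathcal U$ be a finite nonempty subset (a discretization) of $\{\mathbf u:\mathbf 0\preceq\mathbf u\preceq T\mathbf 1\}$. Then the problem $$\min_{\mathbf a\succeq\mathbf 1}\ \max_{\mathbf u\in\mathcal U}\ \frac{f^*(\nabla f_s(\mathbf u))}{f_s(\mathbf u)-f(\mathbf u)}$$ is a quasiconvex optimization problem in the variable $\mathbf a$: the feasible set $\{\mathbf a\in\mathbb R^N:\mathbf a\succeq\mathbf 1\}$ is convex and the objective $\mathbf a\mapsto\max_{\mathbf u\in\mathcal U}\frac{f^*(\nabla f_s(\mathbf u))}{f_s(\mathbf u)-f(\mathbf u)}$ is a quasiconvex function on it.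
   Context: $D,N,T\ge 1$ are integers; $\succeq,\preceq$ are componentwise and $\mathbf 0,\mathbf 1$ are all-zeros and all-ones vectors of the appropriate dimension. A function $g:\mathbb R_+^D\to\mathbb R_+$ satisfies: (F1) if $g$ is convex, differentiable and closed (closed sublevel sets); (F2) if $\mathbf u\succeq\mathbf v$ implies $g(\mathbf u)\ge g(\mathbf v)$; (F3) if $\mathbf u\succeq\mathbf v$ implies $\nabla g(\mathbf u)\succeq\nabla g(\mathbf v)$; (F4) if $g(\mathbf 0)=0$. The convex conjugate is $f^*(\boldsymbol\lambda)=\sup_{\mathbf u\in\mathbb R_+^D}\{\boldsymbol\lambda^\top\mathbf u-f(\mathbf u)\}\in(-\infty,+\infty]$. A function is quasiconvex if its domain is convex and all its sublevel sets $\{\mathbf a:\ \cdot\le\alpha\}$, $\alpha\in\mathbb R$, are convex; extended values $+\infty$ are allowed. A ratio $c/0$ with $c\in(0,+\infty]$ is $+\infty$, and $0/0$ is read as $1$. *)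

theory Defs
  imports "HOL-Analysis.Analysis"
begin

text \<open>
  Functions on $\mathbb{R}_+^D$ are rendered as total functions on \<^typ>\<open>real ^ 'd\<close> of which
  only the values on the closed orthant \<open>{0..}\<close> (componentwise order) are used.  Accordingly,
  differentiability and gradients are taken relative to the orthant, which at a boundary point
  means that only increments staying inside the orthant are considered.
\<close>

definition orthant_grad :: "(real ^ 'd \<Rightarrow> real) \<Rightarrow> real ^ 'd \<Rightarrow> real ^ 'd" where
  "orthant_grad g u = (THE v. (g has_derivative (\<lambda>h. v \<bullet> h)) (at u within {0..}))"

text \<open>The relative gradient is unique at every point of the orthant, so the description above
  denotes it whenever the function is differentiable.\<close>

lemma orthant_grad_eqI:
  fixes g :: "real ^ 'd \<Rightarrow> real"
  assumes u: "0 \<le> u" and D: "(g has_derivative (\<lambda>h. v \<bullet> h)) (at u within {0..})"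
  shows "orthant_grad g u = v"
  unfolding orthant_grad_def
proof (rule the_equality, rule D)
  fix w assume W: "(g has_derivative (\<lambda>h. w \<bullet> h)) (at u within {0..})"
  have "(\<lambda>h. w \<bullet> h) = (\<lambda>h. v \<bullet> h)"
  proof (rule frechet_derivative_unique_within[OF W D])
    fix i :: "real ^ 'd" and e :: real
    assume i: "i \<in> Basis" and e: "0 < e"
    have "0 \<le> i" using i by (auto simp: Basis_vec_def less_eq_vec_def axis_def)
    then have "u + (e / 2) *\<^sub>R i \<in> {0..}"
      using u e by (simp add: less_eq_vec_def)
    then show "\<exists>d. 0 < \<bar>d\<bar> \<and> \<bar>d\<bar> < e \<and> u + d *\<^sub>R i \<in> {0..}"
      using e by (intro exI[of _ "e / 2"]) simp
  qed
  then show "w = v" by (metis vector_eq_rdot inner_commute)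
qed

definition nonneg_on_orthant :: "(real ^ 'd \<Rightarrow> real) \<Rightarrow> bool" where
  "nonneg_on_orthant g \<longleftrightarrow> (\<forall>u\<ge>0. 0 \<le> g u)"

definition F1 :: "(real ^ 'd \<Rightarrow> real) \<Rightarrow> bool" where
  "F1 g \<longleftrightarrow> convex_on {0..} g \<and> g differentiable_on {0..} \<and>
     (\<forall>\<alpha>. closed {u. 0 \<le> u \<and> g u \<le> \<alpha>})"

definition F2 :: "(real ^ 'd \<Rightarrow> real) \<Rightarrow> bool" where
  "F2 g \<longleftrightarrow> (\<forall>u v. 0 \<le> v \<and> v \<le> u \<longrightarrow> g v \<le> g u)"

definition F3 :: "(real ^ 'd \<Rightarrow> real) \<Rightarrow> bool" where
  "F3 g \<longleftrightarrow> (\<forall>u v. 0 \<le> v \<and> v \<le> u \<longrightarrow> orthant_grad g v \<le> orthant_grad g u)"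

definition F4 :: "(real ^ 'd \<Rightarrow> real) \<Rightarrow> bool" where
  "F4 g \<longleftrightarrow> g 0 = 0"

definition conjugate :: "(real ^ 'd \<Rightarrow> real) \<Rightarrow> real ^ 'd \<Rightarrow> ereal" where
  "conjugate f l = (SUP u\<in>{0..}. ereal (l \<bullet> u - f u))"

text \<open>In \<^typ>\<open>ereal\<close>, \<open>c / 0 = \<infinity>\<close> for \<open>c > 0\<close>, but \<open>0 / 0 = 0\<close>; the convention needed here
  is \<open>0 / 0 = 1\<close>.\<close>

definition ratio :: "ereal \<Rightarrow> ereal \<Rightarrow> ereal" where
  "ratio c d = (if c = 0 \<and> d = 0 then 1 else c / d)"

definition quasiconvex_on :: "'a::real_vector set \<Rightarrow> ('a \<Rightarrow> ereal) \<Rightarrow> bool" where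
  "quasiconvex_on S \<phi> \<longleftrightarrow> convex S \<and> (\<forall>\<alpha>::real. convex {a \<in> S. \<phi> a \<le> ereal \<alpha>})"

end

theory Submission
  imports Defs
begin

text \<open>
  Fix a real \<open>\<alpha>\<close>.  The maximum over the finite set \<open>U\<close> is at most \<open>\<alpha>\<close> iff every single ratio is, so
  the sublevel set of the objective is an intersection over \<open>u \<in> U\<close>, and one point \<open>u\<close> may be
  considered at a time.

  For fixed \<open>u\<close>, the gradient \<open>\<nabla>f\<^sub>s(u) = \<Sum>\<^sub>n a\<^sub>n \<nabla>g\<^sub>n(u)\<close> is linear in \<open>a\<close> and the denominator
  \<open>f\<^sub>s(u) - f(u) = \<Sum>\<^sub>n (a\<^sub>n - 1) g\<^sub>n(u)\<close> is affine in \<open>a\<close> and nonnegative for \<open>a \<ge> 1\<close>.  The numerator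
  is nonnegative because \<open>f 0 = 0\<close>.  Clearing the denominator therefore turns ``ratio \<open>\<le> \<alpha>\<close>'' into
  \<open>f\<^sup>*(\<nabla>f\<^sub>s(u)) \<le> \<alpha> (f\<^sub>s(u) - f(u))\<close>, up to the points where the denominator vanishes
  (\<open>ratio_le_ereal_iff\<close>).  As \<open>f\<^sup>*\<close> is a supremum of affine functions, the cleared inequality is a
  family of linear inequalities in \<open>a\<close>, one for each \<open>w \<ge> 0\<close>, and its solutions form a convex set.
  The points with vanishing denominator are harmless: since \<open>0/0\<close> counts as \<open>1\<close>, those satisfying
  the cleared inequality all belong to the sublevel set if \<open>\<alpha> \<ge> 1\<close>, and for \<open>\<alpha> < 1\<close> removing them
  amounts to intersecting with the open half-space where the denominator is positive
  (\<open>convex_ratio_conjugate_sublevel\<close>).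
\<close>

text \<open>Every linear functional on the Euclidean space is an inner product with some vector, so
  differentiability yields a gradient, and uniqueness identifies it with \<open>orthant_grad\<close>.\<close>

lemma has_derivative_orthant_grad:
  fixes g :: "real ^ 'd \<Rightarrow> real"
  assumes u: "0 \<le> u" and D: "g differentiable (at u within {0..})"
  shows "(g has_derivative (\<lambda>h. orthant_grad g u \<bullet> h)) (at u within {0..})"
proof -
  obtain g' where g': "(g has_derivative g') (at u within {0..})"
    using D unfolding differentiable_def by blast
  then have "linear g'"
    by (rule has_derivative_linear)
  then have "g' = (\<lambda>h. adjoint g' 1 \<bullet> h)"
    using adjoint_works[of g' _ 1] by (simp add: fun_eq_iff inner_commute)
  then have "(g has_derivative (\<lambda>h. adjoint g' 1 \<bullet> h)) (at u within {0..})"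
    using g' by metis
  then show ?thesis
    using orthant_grad_eqI[OF u] by metis
qed

lemma orthant_grad_weighted_sum:
  fixes g :: "'n::finite \<Rightarrow> real ^ 'd \<Rightarrow> real"
  assumes u: "0 \<le> u" and D: "\<And>n. g n differentiable (at u within {0..})"
  shows "orthant_grad (\<lambda>u. \<Sum>n\<in>UNIV. a n * g n u) u = (\<Sum>n\<in>UNIV. a n *\<^sub>R orthant_grad (g n) u)"
proof (rule orthant_grad_eqI[OF u])
  have "((\<lambda>u. \<Sum>n\<in>UNIV. a n * g n u) has_derivative
      (\<lambda>h. \<Sum>n\<in>UNIV. a n * (orthant_grad (g n) u \<bullet> h))) (at u within {0..})"
    by (intro has_derivative_sum has_derivative_mult_right has_derivative_orthant_grad u D)
  then show "((\<lambda>u. \<Sum>n\<in>UNIV. a n * g n u) has_derivative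
      (\<lambda>h. (\<Sum>n\<in>UNIV. a n *\<^sub>R orthant_grad (g n) u) \<bullet> h)) (at u within {0..})"
    by (simp add: inner_sum_left)
qed

lemma conjugate_le_ereal_iff:
  "conjugate f l \<le> ereal r \<longleftrightarrow> (\<forall>w\<ge>0. l \<bullet> w - f w \<le> r)"
  unfolding conjugate_def by (auto simp: SUP_le_iff)

lemma conjugate_nonneg:
  assumes "f 0 \<le> 0"
  shows "0 \<le> conjugate f l"
proof -
  have "0 \<le> ereal (l \<bullet> 0 - f 0)"
    using assms by simp
  also have "\<dots> \<le> conjugate f l"
    unfolding conjugate_def by (rule SUP_upper) simp
  finally show ?thesis .
qed

text \<open>If \<open>d = 0\<close>, the cleared inequality \<open>c \<le> \<alpha> d\<close> forces \<open>c = 0\<close>; the quotient is then \<open>0/0\<close>, read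
  as \<open>1\<close>, which is what the second conjunct accounts for.\<close>

lemma ratio_le_ereal_iff:
  assumes "0 \<le> c" and "0 \<le> d"
  shows "ratio c (ereal d) \<le> ereal \<alpha> \<longleftrightarrow> c \<le> ereal (\<alpha> * d) \<and> (d = 0 \<longrightarrow> 1 \<le> \<alpha>)"
proof (cases "d = 0")
  case True
  show ?thesis
  proof (cases "c = 0")
    case True
    then show ?thesis
      using \<open>d = 0\<close> by (simp add: ratio_def zero_ereal_def one_ereal_def)
  next
    case False
    then have "ratio c (ereal d) = \<infinity>" and "\<not> c \<le> 0"
      using \<open>d = 0\<close> \<open>0 \<le> c\<close> by (auto simp: ratio_def divide_ereal_def zero_ereal_def)
    then show ?thesis
      using \<open>d = 0\<close> by (simp add: zero_ereal_def)
  qed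
next
  case False
  then have "0 < d"
    using \<open>0 \<le> d\<close> by simp
  then show ?thesis
    by (cases c) (auto simp: ratio_def field_simps zero_ereal_def)
qed

lemma convex_linear_le:
  fixes \<phi> :: "'a::real_vector \<Rightarrow> real"
  assumes "linear \<phi>"
  shows "convex {a. \<phi> a \<le> r}"
  using convex_linear_vimage[OF assms convex_real_interval(2)[of r]] by (simp add: vimage_def)

lemma convex_linear_gt:
  fixes \<phi> :: "'a::real_vector \<Rightarrow> real"
  assumes "linear \<phi>"
  shows "convex {a. r < \<phi> a}"
  using convex_linear_vimage[OF assms convex_real_interval(3)[of r]] by (simp add: vimage_def)

text \<open>Each \<open>w \<ge> 0\<close> in the supremum defining \<open>conjugate f (L a)\<close> contributes one linear inequality in
  \<open>a\<close>, because \<open>L\<close> and \<open>p\<close> are linear; whether \<open>p a = q\<close> is allowed depends only on \<open>\<alpha>\<close>.\<close>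

lemma convex_ratio_conjugate_sublevel:
  fixes f :: "real ^ 'd \<Rightarrow> real" and L :: "'a::real_vector \<Rightarrow> real ^ 'd" and p :: "'a \<Rightarrow> real"
  assumes f0: "f 0 \<le> 0" and L: "linear L" and p: "linear p"
    and S: "convex S" and nonneg: "\<And>a. a \<in> S \<Longrightarrow> q \<le> p a"
  shows "convex {a \<in> S. ratio (conjugate f (L a)) (ereal (p a - q)) \<le> ereal \<alpha>}"
proof -
  define C where "C = {a. \<forall>w\<ge>0. L a \<bullet> w - \<alpha> * p a \<le> f w - \<alpha> * q}"
  have lin: "linear (\<lambda>a. L a \<bullet> w - \<alpha> * p a)" for w
    by (rule linearI)
      (simp_all add: linear_add[OF L] linear_add[OF p] linear_scale[OF L] linear_scale[OF p]
        inner_add_left algebra_simps)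
  have "C = (\<Inter>w\<in>{0..}. {a. L a \<bullet> w - \<alpha> * p a \<le> f w - \<alpha> * q})"
    by (auto simp: C_def)
  then have C: "convex C"
    by (simp only:) (intro convex_INT convex_linear_le lin)
  have iff: "ratio (conjugate f (L a)) (ereal (p a - q)) \<le> ereal \<alpha> \<longleftrightarrow>
      a \<in> C \<and> (p a = q \<longrightarrow> 1 \<le> \<alpha>)" if "a \<in> S" for a
    using nonneg[OF that] conjugate_nonneg[where f = f, OF f0]
    by (simp add: ratio_le_ereal_iff conjugate_le_ereal_iff C_def algebra_simps)
  show ?thesis
  proof (cases "1 \<le> \<alpha>")
    case True
    then have "{a \<in> S. ratio (conjugate f (L a)) (ereal (p a - q)) \<le> ereal \<alpha>} = S \<inter> C"
      using iff by auto
    then show ?thesis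
      using S C by (simp add: convex_Int)
  next
    case False
    then have "{a \<in> S. ratio (conjugate f (L a)) (ereal (p a - q)) \<le> ereal \<alpha>} =
        S \<inter> C \<inter> {a. q < p a}"
      using iff nonneg by force
    then show ?thesis
      using S C convex_linear_gt[OF p] by (simp add: convex_Int)
  qed
qed

lemma convex_vec_atLeast: "convex {a :: real ^ 'n::finite. b \<le> a}"
proof -
  have "{a :: real ^ 'n. b \<le> a} = (\<Inter>i. {a. axis i 1 \<bullet> a \<ge> b $ i})"
    by (auto simp: less_eq_vec_def inner_axis')
  then show ?thesis
    by (simp only:) (intro convex_INT convex_halfspace_ge)
qed

theorem theorem5p2:
  fixes g :: "'n::finite \<Rightarrow> real ^ 'd \<Rightarrow> real"
    and f :: "real ^ 'd \<Rightarrow> real"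
    and fs :: "real ^ 'n \<Rightarrow> real ^ 'd \<Rightarrow> real"
    and T :: nat
    and U :: "(real ^ 'd) set"
  assumes "\<And>n. nonneg_on_orthant (g n)"
    and "\<And>n. F1 (g n)" and "\<And>n. F2 (g n)" and "\<And>n. F3 (g n)" and "\<And>n. F4 (g n)"
    and "f = (\<lambda>u. \<Sum>n\<in>UNIV. g n u)"
    and "fs = (\<lambda>a u. \<Sum>n\<in>UNIV. a $ n * g n u)"
    and "T \<ge> 1"
    and "finite U" and "U \<noteq> {}" and "U \<subseteq> {u. 0 \<le> u \<and> u \<le> real T *\<^sub>R 1}"
  shows "convex {a :: real ^ 'n. 1 \<le> a} \<and>
    quasiconvex_on {a :: real ^ 'n. 1 \<le> a}
      (\<lambda>a. MAX u\<in>U. ratio (conjugate f (orthant_grad (fs a) u)) (ereal (fs a u - f u)))"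
proof
  let ?S = "{a :: real ^ 'n. 1 \<le> a}"
  let ?q = "\<lambda>u a. ratio (conjugate f (orthant_grad (fs a) u)) (ereal (fs a u - f u))"
  show S: "convex ?S"
    by (rule convex_vec_atLeast)
  have sublevel: "convex {a \<in> ?S. ?q u a \<le> ereal \<alpha>}" if "u \<in> U" for u \<alpha>
  proof -
    have u: "0 \<le> u"
      using that assms(11) by auto
    have D: "g n differentiable (at u within {0..})" for n
      using assms(2)[of n] u by (simp add: F1_def differentiable_on_def)
    define L where "L a = (\<Sum>n\<in>UNIV. a $ n *\<^sub>R orthant_grad (g n) u)" for a :: "real ^ 'n"
    have grad: "orthant_grad (fs a) u = L a" for a
      unfolding assms(7) L_def by (rule orthant_grad_weighted_sum[OF u D])
    have L: "linear L"
      by (rule linearI)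
        (simp_all add: L_def scaleR_add_left sum.distrib scaleR_sum_right)
    have p: "linear (\<lambda>a. fs a u)"
      by (rule linearI)
        (simp_all add: assms(7) distrib_right sum.distrib sum_distrib_left mult.assoc)
    have f0: "f 0 \<le> 0"
      using assms(5) by (simp add: assms(6) F4_def)
    have nonneg: "f u \<le> fs a u" if "a \<in> ?S" for a
      unfolding assms(6,7)
    proof (rule sum_mono)
      fix n
      have "1 \<le> a $ n" and "0 \<le> g n u"
        using that u assms(1)[of n] by (auto simp: less_eq_vec_def nonneg_on_orthant_def)
      then show "g n u \<le> a $ n * g n u"
        using mult_right_mono[of 1 "a $ n" "g n u"] by simp
    qed
    show ?thesis
      unfolding grad by (rule convex_ratio_conjugate_sublevel[where f = f and p = "\<lambda>a. fs a u", OF f0 L p S nonneg])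
  qed
  have "convex {a \<in> ?S. (MAX u\<in>U. ?q u a) \<le> ereal \<alpha>}" for \<alpha>
  proof -
    have "{a \<in> ?S. (MAX u\<in>U. ?q u a) \<le> ereal \<alpha>} = (\<Inter>u\<in>U. {a \<in> ?S. ?q u a \<le> ereal \<alpha>})"
      using assms(9,10) by auto
    then show ?thesis
      by (simp only:) (intro convex_INT sublevel)
  qed
  then show "quasiconvex_on ?S (\<lambda>a. MAX u\<in>U. ?q u a)"
    using S by (simp add: quasiconvex_on_def)
qed

end
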